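(* Let $H_n$ be the ensemble of random matrices of the long-range percolation model described in the context and let $g_{n,b}(z)=\frac1N\operatorname{Tr}(H_n-zI)^{-1}$, $b=b_n$. Assume that $\mathbf{E}\{a(i,p)^{2l+1}\}=0$ for $l=0,1,2$ and $$\mathbf{E}\{a(i,p)^2\}=v^2,\qquad \mathbf{E}\{a(i,p)^4\}=3v^4,\qquad \mathbf{E}\{a(i,p)^6\}=15v^6$$ for all $i,p$, and that $\hat\mu_7=\sup_{i,p}\mathbf{E}\{|a(i,p)|^7\}<\infty$. Then, for all $z\in\Lambda_\eta=\{z\in\mathbb{C}:|\operatorname{Im}z|\ge\eta\}$ with $\eta=2v+1$, the estimate $$\mathbf{Var}\{g_{n,b}(z)\}=O\!\left(\frac1b\right)$$ holds for large enough $n$ and $b$, in the limit $n\to\infty$, $b\to\infty$, $b/n\to0$.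
   Context: Setting. Let $v>0$ and let $\{a(i,j): i\le j,\ i,j\in\mathbb{Z}\}$ be independent real random variables with $\mathbf{E}\{a(i,j)\}=0$ and $\mathbf{E}\{a(i,j)^2\}=v^2$ (with $a(j,i)=a(i,j)$). Let $\psi:\mathbb{R}\to[0,1]$ be a continuous even function, non-increasing on $[0,\infty)$ and vanishing at infinity, with $\int_{\mathbb{R}}\psi(t)\,dt=1$. Let $N=2n+1$ and let $b=b_n$ be a sequence of integers with $0<b_n\le N$, $b_n\to\infty$ and $b_n/n\to0$ as $n\to\infty$. For each $n$ let $\{d(i,j): -n\le i\le j\le n\}$ be independent Bernoulli random variables, independent of the family $\{a(i,j)\}$ and defined on the same probability space, with $d(i,j)=1$ with probability $\psi((i-j)/b_n)$ and $d(i,j)=0$ with probability $1-\psi((i-j)/b_n)$. Define the real symmetric $N\times N$ random matrix $H_n$, with rows and columns indexed by $\{-n,\dots,n\}$, by $H_n(i,j)=H_n(j,i)=b_n^{-1/2}a(i,j)d(i,j)$ for $i\le j$. For a complex random variable $\zeta$, $\mathbf{Var}\{\zeta\}=\mathbf{E}|\zeta-\mathbf{E}\zeta|^2$. *)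

theory Defs
  imports
    "HOL-Probability.Probability"
    "HOL-Library.Landau_Symbols"
    "Jordan_Normal_Form.Gauss_Jordan_Elimination"
begin

locale long_range_percolation = prob_space M
  for M :: "'w measure"
    and v :: real
    and \<psi> :: "real \<Rightarrow> real"
    and b :: "nat \<Rightarrow> nat"
    and a :: "int \<Rightarrow> int \<Rightarrow> 'w \<Rightarrow> real"
    and d :: "nat \<Rightarrow> int \<Rightarrow> int \<Rightarrow> 'w \<Rightarrow> real" +
  assumes v_pos: "v > 0"
    and a_indep: "indep_vars (\<lambda>_. borel) (\<lambda>(i, j). a i j) {(i, j). i \<le> j}"
    and a_sym: "a j i = a i j"
    and a_mean: "i \<le> j \<Longrightarrow> expectation (a i j) = 0"
    and a_second_moment: "i \<le> j \<Longrightarrow> expectation (\<lambda>\<omega>. (a i j \<omega>)\<^sup>2) = v\<^sup>2"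
    and psi_range: "0 \<le> \<psi> t" "\<psi> t \<le> 1"
    and psi_cont: "continuous_on UNIV \<psi>"
    and psi_even: "\<psi> (- t) = \<psi> t"
    and psi_antimono: "antimono_on {0..} \<psi>"
    and psi_vanish: "(\<psi> \<longlongrightarrow> 0) at_infinity"
    and psi_integral: "has_bochner_integral lborel \<psi> 1"
    and b_pos: "0 < b n"
    and b_le: "b n \<le> 2 * n + 1"
    and b_at_top: "filterlim b at_top sequentially"
    and b_small: "(\<lambda>n. real (b n) / real n) \<longlonglongrightarrow> 0"
    and d_indep: "indep_vars (\<lambda>_. borel) (\<lambda>(i, j). d n i j)
      {(i, j). - int n \<le> i \<and> i \<le> j \<and> j \<le> int n}"
    and d_one: "- int n \<le> i \<Longrightarrow> i \<le> j \<Longrightarrow> j \<le> int n \<Longrightarrow>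
      prob {\<omega> \<in> space M. d n i j \<omega> = 1} = \<psi> (of_int (i - j) / real (b n))"
    and d_zero: "- int n \<le> i \<Longrightarrow> i \<le> j \<Longrightarrow> j \<le> int n \<Longrightarrow>
      prob {\<omega> \<in> space M. d n i j \<omega> = 0} = 1 - \<psi> (of_int (i - j) / real (b n))"
    and d_indep_a: "indep_var
      (Pi\<^sub>M {(i, j). - int n \<le> i \<and> i \<le> j \<and> j \<le> int n} (\<lambda>_. borel))
      (\<lambda>\<omega>. \<lambda>(i, j)\<in>{(i, j). - int n \<le> i \<and> i \<le> j \<and> j \<le> int n}. d n i j \<omega>)
      (Pi\<^sub>M {(i, j). i \<le> j} (\<lambda>_. borel))
      (\<lambda>\<omega>. \<lambda>(i, j)\<in>{(i, j). i \<le> j}. a i j \<omega>)"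

definition H_entry ::
  "(nat \<Rightarrow> nat) \<Rightarrow> (int \<Rightarrow> int \<Rightarrow> 'w \<Rightarrow> real) \<Rightarrow> (nat \<Rightarrow> int \<Rightarrow> int \<Rightarrow> 'w \<Rightarrow> real) \<Rightarrow>
    nat \<Rightarrow> 'w \<Rightarrow> int \<Rightarrow> int \<Rightarrow> real" where
  "H_entry b a d n \<omega> i j =
    a (min i j) (max i j) \<omega> * d n (min i j) (max i j) \<omega> / sqrt (real (b n))"

text \<open>Matrices of the imported theory are indexed from 0, so row \<open>r\<close> stands for the
  index \<open>r - n\<close> in \<open>{-n..n}\<close>.\<close>

definition H_mat ::
  "(nat \<Rightarrow> nat) \<Rightarrow> (int \<Rightarrow> int \<Rightarrow> 'w \<Rightarrow> real) \<Rightarrow> (nat \<Rightarrow> int \<Rightarrow> int \<Rightarrow> 'w \<Rightarrow> real) \<Rightarrow>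
    nat \<Rightarrow> 'w \<Rightarrow> complex mat" where
  "H_mat b a d n \<omega> = mat (2 * n + 1) (2 * n + 1)
    (\<lambda>(r, c). complex_of_real (H_entry b a d n \<omega> (int r - int n) (int c - int n)))"

definition mat_trace :: "'a :: comm_monoid_add mat \<Rightarrow> 'a" where
  "mat_trace A = (\<Sum>i<dim_row A. A $$ (i, i))"

text \<open>The value of \<open>the (mat_inverse A)\<close> is the inverse of \<open>A\<close> only if \<open>A\<close> is invertible.
  The matrix \<open>H_mat b a d n \<omega>\<close> is real symmetric, so this is the case below whenever
  \<open>z\<close> is not real.\<close>

definition resolvent_trace ::
  "(nat \<Rightarrow> nat) \<Rightarrow> (int \<Rightarrow> int \<Rightarrow> 'w \<Rightarrow> real) \<Rightarrow> (nat \<Rightarrow> int \<Rightarrow> int \<Rightarrow> 'w \<Rightarrow> real) \<Rightarrow>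
    nat \<Rightarrow> complex \<Rightarrow> 'w \<Rightarrow> complex" where
  "resolvent_trace b a d n z \<omega> =
    mat_trace (the (mat_inverse (H_mat b a d n \<omega> - z \<cdot>\<^sub>m 1\<^sub>m (2 * n + 1)))) / of_nat (2 * n + 1)"

definition complex_variance :: "'w measure \<Rightarrow> ('w \<Rightarrow> complex) \<Rightarrow> real" where
  "complex_variance M \<zeta> = (\<integral>\<omega>. (cmod (\<zeta> \<omega> - (\<integral>\<omega>'. \<zeta> \<omega>' \<partial>M)))\<^sup>2 \<partial>M)"

end

theory Submission
  imports Defs "Jordan_Normal_Form.Determinant"
begin

text \<open>
  The variance of the normalised trace \<open>g\<close> of the resolvent is of order \<open>1 / N\<close>, with \<open>N = 2 n + 1\<close>
  the size of the matrix, for every symmetric random matrix whose upper triangle is independent;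
  since \<open>b n \<le> N\<close>, this is \<open>O(1 / b n)\<close>.

  The reason is an averaging effect over rows. Group the random variables of the matrix by rows,
  row \<open>k\<close> receiving the variables on and to the right of the diagonal. These blocks are independent,
  and replacing the block of row \<open>k\<close> by any other values changes only row and column \<open>k\<close> of the
  matrix, hence is a perturbation of rank at most two. The trace of the resolvent of a symmetric
  matrix moves by at most \<open>1 / \<bar>Im z\<bar>\<close> under a real symmetric rank-one perturbation, however large
  (\<open>trace_resolvent_rank_one\<close>), so the replacement moves \<open>g\<close> by at most \<open>2 / (N \<bar>Im z\<bar>)\<close>
  (\<open>trace_resolvent_row_change\<close>). The Efron-Stein inequality for functions with bounded differences
  (\<open>variance_bounded_differences\<close>) then adds up the squares of these \<open>N\<close> differences and yields
  \<open>Var g \<le> 8 / (N \<bar>Im z\<bar>\<^sup>2)\<close>, the constant covering the real and the imaginary part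
  (\<open>complex_variance_resolvent_trace_le\<close>). On the region considered, \<open>\<bar>Im z\<bar> \<ge> 1\<close>.
\<close>

section \<open>Resolvents of real symmetric matrices\<close>

text \<open>
  Matrices are given by their entries as functions of two natural numbers, only the values below
  \<open>N\<close> being read. This keeps rank-one updates and changes of a single row free of dimension
  side conditions.
\<close>

definition shifted_mat :: "nat \<Rightarrow> complex \<Rightarrow> (nat \<Rightarrow> nat \<Rightarrow> real) \<Rightarrow> complex mat" where
  "shifted_mat N z h = mat N N (\<lambda>(i, j). complex_of_real (h i j)) - z \<cdot>\<^sub>m 1\<^sub>m N"

definition resolvent :: "nat \<Rightarrow> complex \<Rightarrow> (nat \<Rightarrow> nat \<Rightarrow> real) \<Rightarrow> complex mat" where
  "resolvent N z h = the (mat_inverse (shifted_mat N z h))"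

definition symmetric_on :: "nat \<Rightarrow> (nat \<Rightarrow> nat \<Rightarrow> real) \<Rightarrow> bool" where
  "symmetric_on N h \<longleftrightarrow> (\<forall>i<N. \<forall>j<N. h i j = h j i)"

lemma shifted_mat_carrier: "shifted_mat N z h \<in> carrier_mat N N"
  by (auto simp: shifted_mat_def)

lemma shifted_mat_index:
  "i < N \<Longrightarrow> j < N \<Longrightarrow>
    shifted_mat N z h $$ (i, j) = of_real (h i j) - (if i = j then z else 0)"
  by (auto simp: shifted_mat_def)

lemma mult_mat_index:
  assumes "A \<in> carrier_mat N N" "B \<in> carrier_mat N N" "i < N" "j < N"
  shows "(A * B) $$ (i, j) = (\<Sum>k<N. A $$ (i, k) * B $$ (k, j))"
  using assms by (auto simp: scalar_prod_def lessThan_atLeast0)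

lemma symmetric_form_real:
  assumes "symmetric_on N h"
  shows "Im (\<Sum>i<N. \<Sum>j<N. cnj (y i) * of_real (h i j) * y j) = 0"
proof -
  let ?s = "\<Sum>i<N. \<Sum>j<N. cnj (y i) * of_real (h i j) * y j"
  have "cnj ?s = (\<Sum>i<N. \<Sum>j<N. cnj (y j) * of_real (h j i) * y i)"
    unfolding cnj_sum
    by (intro sum.cong refl) (use assms in \<open>auto simp: symmetric_on_def ac_simps\<close>)
  also have "\<dots> = ?s" by (rule sum.swap)
  finally have "cnj ?s = ?s" .
  moreover have "Im w = 0" if "cnj w = w" for w
    using arg_cong[OF that, of Im] by simp
  ultimately show ?thesis by blast
qed

text \<open>
  If \<open>(H - z) y = u\<close> with \<open>u\<close> real, pair the equation with the conjugate of \<open>y\<close>: the quadratic form of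
  \<open>H\<close> is real, so only \<open>- z\<close> times the squared norm of \<open>y\<close> contributes to the imaginary part. Every
  estimate on the resolvent below comes from this identity.
\<close>

lemma shifted_mat_energy:
  assumes "symmetric_on N h"
    and "\<And>i. i < N \<Longrightarrow> (\<Sum>j<N. shifted_mat N z h $$ (i, j) * y j) = of_real (u i)"
  shows "Im (\<Sum>i<N. of_real (u i) * y i) = Im z * (\<Sum>i<N. (cmod (y i))\<^sup>2)"
proof -
  have row: "(\<Sum>j<N. of_real (h i j) * y j) - z * y i = of_real (u i)" if "i < N" for i
  proof -
    have "(\<Sum>j<N. of_real (h i j) * y j) - z * y i
      = (\<Sum>j<N. of_real (h i j) * y j - (if i = j then z * y j else 0))"
      using that by (simp add: sum_subtractf)
    also have "\<dots> = (\<Sum>j<N. shifted_mat N z h $$ (i, j) * y j)"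
      using that by (intro sum.cong) (auto simp: shifted_mat_index algebra_simps)
    finally show ?thesis using assms(2)[OF that] by simp
  qed
  have "(\<Sum>i<N. cnj (y i) * of_real (u i))
    = (\<Sum>i<N. cnj (y i) * ((\<Sum>j<N. of_real (h i j) * y j) - z * y i))"
    using row by (intro sum.cong) auto
  also have "\<dots> = (\<Sum>i<N. \<Sum>j<N. cnj (y i) * of_real (h i j) * y j)
      - z * (\<Sum>i<N. y i * cnj (y i))"
    by (simp add: algebra_simps sum_subtractf sum_distrib_left)
  also have "(\<Sum>i<N. y i * cnj (y i)) = of_real (\<Sum>i<N. (cmod (y i))\<^sup>2)"
    by (simp only: complex_norm_square of_real_sum)
  finally have "Im (\<Sum>i<N. cnj (y i) * of_real (u i)) = - Im z * (\<Sum>i<N. (cmod (y i))\<^sup>2)"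
    using symmetric_form_real[OF assms(1), of y] by simp
  then show ?thesis by (simp add: sum_negf mult.commute)
qed

lemma det_shifted_mat_nonzero:
  assumes "symmetric_on N h" "Im z \<noteq> 0"
  shows "Determinant.det (shifted_mat N z h) \<noteq> 0"
proof
  assume "Determinant.det (shifted_mat N z h) = 0"
  then obtain w where w: "w \<in> carrier_vec N" "w \<noteq> 0\<^sub>v N"
      "shifted_mat N z h *\<^sub>v w = 0\<^sub>v N"
    using det_0_iff_vec_prod_zero_field[OF shifted_mat_carrier] by blast
  have "(\<Sum>j<N. shifted_mat N z h $$ (i, j) * (w $ j)) = of_real 0" if "i < N" for i
  proof -
    have "(shifted_mat N z h *\<^sub>v w) $ i = (\<Sum>j<N. shifted_mat N z h $$ (i, j) * (w $ j))"
      using that w(1) shifted_mat_carrier[of N z h]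
      by (auto simp: scalar_prod_def lessThan_atLeast0)
    then show ?thesis using that w(3) by simp
  qed
  then have "Im z * (\<Sum>i<N. (cmod (w $ i))\<^sup>2) = 0"
    using shifted_mat_energy[OF assms(1), of z "\<lambda>i. w $ i" "\<lambda>_. 0"] by simp
  then have "\<forall>i<N. w $ i = 0"
    using assms(2) by (auto simp: sum_nonneg_eq_0_iff)
  then show False using w by auto
qed

lemma resolvent_inverse:
  assumes "symmetric_on N h" "Im z \<noteq> 0"
  shows "resolvent N z h \<in> carrier_mat N N"
    and "shifted_mat N z h * resolvent N z h = 1\<^sub>m N"
    and "resolvent N z h * shifted_mat N z h = 1\<^sub>m N"
proof -
  have "mat_inverse (shifted_mat N z h) \<noteq> None"
    using mat_inverse(1)[OF shifted_mat_carrier, where b = "()"]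
      det_non_zero_imp_unit[OF shifted_mat_carrier det_shifted_mat_nonzero[OF assms], of "()"]
    by blast
  then obtain G where G: "mat_inverse (shifted_mat N z h) = Some G" by auto
  show "resolvent N z h \<in> carrier_mat N N"
    and "shifted_mat N z h * resolvent N z h = 1\<^sub>m N"
    and "resolvent N z h * shifted_mat N z h = 1\<^sub>m N"
    using mat_inverse(2)[OF shifted_mat_carrier G] by (auto simp: resolvent_def G)
qed

lemma resolvent_unique:
  assumes "symmetric_on N h" "Im z \<noteq> 0" "B \<in> carrier_mat N N" "B * shifted_mat N z h = 1\<^sub>m N"
  shows "resolvent N z h = B"
proof -
  have "B = B * (shifted_mat N z h * resolvent N z h)"
    using assms resolvent_inverse(2)[OF assms(1,2)] by simp
  also have "\<dots> = B * shifted_mat N z h * resolvent N z h"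
    using assms(3) shifted_mat_carrier[of N z h] resolvent_inverse(1)[OF assms(1,2)]
    by (simp add: assoc_mult_mat)
  finally show ?thesis using assms(4) resolvent_inverse(1)[OF assms(1,2)] by simp
qed

lemma resolvent_symmetric:
  assumes "symmetric_on N h" "Im z \<noteq> 0" "i < N" "j < N"
  shows "resolvent N z h $$ (i, j) = resolvent N z h $$ (j, i)"
proof -
  let ?A = "shifted_mat N z h" and ?G = "resolvent N z h"
  note G = resolvent_inverse[OF assms(1,2)]
  have At: "transpose_mat ?A = ?A"
    using shifted_mat_carrier[of N z h] assms(1)
    by (intro eq_matI) (auto simp: shifted_mat_index symmetric_on_def)
  have "transpose_mat ?G * ?A = transpose_mat (?A * ?G)"
    using transpose_mult[OF shifted_mat_carrier G(1)] At by simp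
  then have "?G = transpose_mat ?G"
    using G by (intro resolvent_unique[OF assms(1,2)]) auto
  then show ?thesis
    using assms(3,4) G(1) by (metis carrier_matD index_transpose_mat(1))
qed

text \<open>
  The vector \<open>y = G w\<close> solves \<open>(H - z) y = w\<close>; this is the form in which
  the energy identity is applied to resolvents.
\<close>

lemma shifted_mat_mult_resolvent_sum:
  assumes "symmetric_on N h" "Im z \<noteq> 0" "i < N"
  shows "(\<Sum>j<N. shifted_mat N z h $$ (i, j) * (\<Sum>k<N. resolvent N z h $$ (j, k) * w k)) = w i"
proof -
  note G = resolvent_inverse[OF assms(1,2)]
  have "(\<Sum>j<N. shifted_mat N z h $$ (i, j) * (\<Sum>k<N. resolvent N z h $$ (j, k) * w k))
    = (\<Sum>j<N. \<Sum>k<N. shifted_mat N z h $$ (i, j) * resolvent N z h $$ (j, k) * w k)"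
    by (simp add: sum_distrib_left mult.assoc)
  also have "\<dots> = (\<Sum>k<N. \<Sum>j<N. shifted_mat N z h $$ (i, j) * resolvent N z h $$ (j, k) * w k)"
    by (rule sum.swap)
  also have "\<dots> = (\<Sum>k<N. (shifted_mat N z h * resolvent N z h) $$ (i, k) * w k)"
    using assms(3)
    by (intro sum.cong refl)
      (simp add: mult_mat_index[OF shifted_mat_carrier G(1)] sum_distrib_right del: index_mult_mat)
  also have "\<dots> = (\<Sum>k<N. if k = i then w k else 0)"
    using assms(3) by (intro sum.cong refl) (auto simp: G(2))
  also have "\<dots> = w i" using assms(3) by simp
  finally show ?thesis .
qed

lemma resolvent_form:
  assumes "symmetric_on N h" "Im z \<noteq> 0"
  defines "y \<equiv> \<lambda>u i. \<Sum>k<N. resolvent N z h $$ (i, k) * complex_of_real (u k)"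
  shows "Im (\<Sum>i<N. of_real (u i) * y u i) = Im z * (\<Sum>i<N. (cmod (y u i))\<^sup>2)"
  unfolding y_def
  by (intro shifted_mat_energy[OF assms(1)] shifted_mat_mult_resolvent_sum assms)

text \<open>
  With \<open>u\<close> the \<open>i\<close>-th unit vector, \<open>y\<close> is the \<open>i\<close>-th column of the resolvent \<open>G\<close>, and the energy
  identity gives \<open>\<bar>Im z\<bar> \<bar>G\<^sub>i\<^sub>i\<bar>\<^sup>2 \<le> \<bar>Im G\<^sub>i\<^sub>i\<bar> \<le> \<bar>G\<^sub>i\<^sub>i\<bar>\<close>. The resulting bound
  on the trace makes it integrable.
\<close>

lemma cmod_resolvent_diag_le:
  assumes "symmetric_on N h" "Im z \<noteq> 0" "i < N"
  shows "cmod (resolvent N z h $$ (i, i)) \<le> 1 / \<bar>Im z\<bar>"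
proof -
  define g where "g = resolvent N z h $$ (i, i)"
  let ?u = "\<lambda>k. if k = i then 1 else 0 :: real"
  let ?y = "\<lambda>j. \<Sum>k<N. resolvent N z h $$ (j, k) * complex_of_real (?u k)"
  have y: "?y j = resolvent N z h $$ (j, i)" for j
  proof -
    have "?y j = (\<Sum>k<N. if k = i then resolvent N z h $$ (j, k) else 0)"
      by (intro sum.cong) auto
    then show ?thesis using assms(3) by simp
  qed
  have form: "Im (\<Sum>j<N. of_real (?u j) * ?y j) = Im z * (\<Sum>j<N. (cmod (?y j))\<^sup>2)"
    by (rule resolvent_form[OF assms(1,2)])
  have "(\<Sum>j<N. of_real (?u j) * ?y j) = (\<Sum>j<N. if j = i then resolvent N z h $$ (j, i) else 0)"
    unfolding y by (intro sum.cong) auto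
  also have "\<dots> = g" using assms(3) by (simp add: g_def)
  finally have *: "Im g = Im z * (\<Sum>j<N. (cmod (resolvent N z h $$ (j, i)))\<^sup>2)"
    using form unfolding y by simp
  have "(cmod g)\<^sup>2 \<le> (\<Sum>j<N. (cmod (resolvent N z h $$ (j, i)))\<^sup>2)"
    unfolding g_def using assms(3)
    by (intro member_le_sum[of i "{..<N}" "\<lambda>j. (cmod (resolvent N z h $$ (j, i)))\<^sup>2"]) auto
  then have "\<bar>Im z\<bar> * (cmod g)\<^sup>2 \<le> \<bar>Im z\<bar> * \<bar>\<Sum>j<N. (cmod (resolvent N z h $$ (j, i)))\<^sup>2\<bar>"
    by (intro mult_left_mono) auto
  also have "\<dots> = \<bar>Im g\<bar>" by (simp add: * abs_mult)
  also have "\<dots> \<le> cmod g" by (rule abs_Im_le_cmod)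
  finally have "cmod g * (\<bar>Im z\<bar> * cmod g) \<le> cmod g * 1"
    by (simp add: power2_eq_square ac_simps)
  then have "cmod g = 0 \<or> \<bar>Im z\<bar> * cmod g \<le> 1"
    by (metis mult_le_cancel_left_pos norm_ge_zero order_le_less)
  then show ?thesis using assms(2) unfolding g_def[symmetric] by (auto simp: field_simps)
qed

lemma mat_trace_resolvent:
  assumes "symmetric_on N h" "Im z \<noteq> 0"
  shows "mat_trace (resolvent N z h) = (\<Sum>i<N. resolvent N z h $$ (i, i))"
  using resolvent_inverse(1)[OF assms] by (auto simp: mat_trace_def)

lemma cmod_trace_resolvent_le:
  assumes "symmetric_on N h" "Im z \<noteq> 0"
  shows "cmod (mat_trace (resolvent N z h)) \<le> real N / \<bar>Im z\<bar>"
proof -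
  have "cmod (mat_trace (resolvent N z h)) \<le> (\<Sum>i<N. cmod (resolvent N z h $$ (i, i)))"
    unfolding mat_trace_resolvent[OF assms] by (rule norm_sum)
  also have "\<dots> \<le> (\<Sum>i<N. 1 / \<bar>Im z\<bar>)"
    by (intro sum_mono cmod_resolvent_diag_le assms) auto
  finally show ?thesis by simp
qed

text \<open>
  The resolvent identity \<open>G = G' + G (H' - H) G'\<close> for \<open>H' = H + t u u\<^sup>T\<close>, with the symmetry of \<open>G'\<close>
  used to write the correction as the outer product of \<open>y = G u\<close> and \<open>x = G' u\<close>.
\<close>

lemma resolvent_rank_one_identity:
  assumes h: "symmetric_on N h" and z: "Im z \<noteq> 0"
    and h': "\<And>i j. i < N \<Longrightarrow> j < N \<Longrightarrow> h' i j = h i j + t * u i * u j"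
    and ij: "i < N" "j < N"
  defines "y \<equiv> \<lambda>i. \<Sum>k<N. resolvent N z h $$ (i, k) * complex_of_real (u k)"
    and "x \<equiv> \<lambda>i. \<Sum>k<N. resolvent N z h' $$ (i, k) * complex_of_real (u k)"
  shows "resolvent N z h $$ (i, j) = resolvent N z h' $$ (i, j) + of_real t * y i * x j"
proof -
  have s': "symmetric_on N h'" using h h' by (auto simp: symmetric_on_def)
  note G = resolvent_inverse[OF h z] and G' = resolvent_inverse[OF s' z]
  let ?A = "shifted_mat N z h" and ?A' = "shifted_mat N z h'"
  let ?G = "resolvent N z h" and ?G' = "resolvent N z h'"
  have c: "?A \<in> carrier_mat N N" "?A' \<in> carrier_mat N N"
    by (rule shifted_mat_carrier)+
  have x: "(\<Sum>k<N. complex_of_real (u k) * ?G' $$ (k, j)) = x j"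
    unfolding x_def using ij(2)
    by (intro sum.cong refl) (simp add: resolvent_symmetric[OF s' z ij(2)] mult.commute)
  have A': "?A' $$ (k, l) = ?A $$ (k, l) + of_real t * of_real (u k) * of_real (u l)"
    if "k < N" "l < N" for k l
    using that h' by (simp add: shifted_mat_index)
  have "?G $$ (i, j) = (\<Sum>k<N. ?G $$ (i, k) * (?A' * ?G') $$ (k, j))"
  proof -
    have "(\<Sum>k<N. ?G $$ (i, k) * (?A' * ?G') $$ (k, j)) = (\<Sum>k<N. if k = j then ?G $$ (i, k) else 0)"
      unfolding G'(2) using ij by (intro sum.cong) auto
    then show ?thesis using ij by simp
  qed
  also have "\<dots> = (\<Sum>k<N. ?G $$ (i, k) * ((?A * ?G') $$ (k, j) + of_real t * of_real (u k) * x j))"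
  proof (intro sum.cong refl arg_cong2[where f = "(*)"])
    fix k assume k: "k \<in> {..<N}"
    have "(?A' * ?G') $$ (k, j) = (\<Sum>l<N. ?A' $$ (k, l) * ?G' $$ (l, j))"
      using k ij c G'(1) by (intro mult_mat_index) auto
    also have "\<dots> = (\<Sum>l<N. ?A $$ (k, l) * ?G' $$ (l, j))
        + (\<Sum>l<N. of_real t * of_real (u k) * (of_real (u l) * ?G' $$ (l, j)))"
      unfolding sum.distrib[symmetric] using k
      by (intro sum.cong refl) (simp add: A' algebra_simps)
    also have "(\<Sum>l<N. ?A $$ (k, l) * ?G' $$ (l, j)) = (?A * ?G') $$ (k, j)"
      using k ij c G'(1) by (intro mult_mat_index[symmetric]) auto
    also have "(\<Sum>l<N. of_real t * of_real (u k) * (of_real (u l) * ?G' $$ (l, j)))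
      = of_real t * of_real (u k) * x j"
      unfolding sum_distrib_left[symmetric] x ..
    finally show "(?A' * ?G') $$ (k, j) = (?A * ?G') $$ (k, j) + of_real t * of_real (u k) * x j" .
  qed
  also have "\<dots> = (\<Sum>k<N. ?G $$ (i, k) * (?A * ?G') $$ (k, j)) + of_real t * y i * x j"
    unfolding y_def
    by (simp add: distrib_left sum.distrib sum_distrib_left sum_distrib_right ac_simps)
  also have "(\<Sum>k<N. ?G $$ (i, k) * (?A * ?G') $$ (k, j)) = (?G * (?A * ?G')) $$ (i, j)"
    using c G(1) G'(1) ij by (intro mult_mat_index[symmetric]) auto
  also have "?G * (?A * ?G') = ?G * ?A * ?G'"
    using c G(1) G'(1) by (simp add: assoc_mult_mat)
  also have "\<dots> = ?G'" using G(3) G'(1) by simp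
  finally show ?thesis .
qed

text \<open>
  A bound that does not depend on the size of the perturbation. Since \<open>x = s y\<close> with
  \<open>s (1 + t u\<^sup>T y) = 1\<close>, the difference of the traces is \<open>t y\<^sup>T y / (1 + t u\<^sup>T y)\<close>. Here \<open>\<bar>y\<^sup>T y\<bar>\<close> is at most
  the squared norm of \<open>y\<close>, while the energy identity bounds the imaginary part of the
  denominator below by \<open>\<bar>t\<bar> \<bar>Im z\<bar>\<close> times the same squared norm, so both cancel.
\<close>

lemma trace_resolvent_rank_one:
  assumes h: "symmetric_on N h" and z: "Im z \<noteq> 0"
    and h': "\<And>i j. i < N \<Longrightarrow> j < N \<Longrightarrow> h' i j = h i j + t * u i * u j"
  shows "cmod (mat_trace (resolvent N z h) - mat_trace (resolvent N z h')) \<le> 1 / \<bar>Im z\<bar>"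
proof -
  have s': "symmetric_on N h'" using h h' by (auto simp: symmetric_on_def)
  define y where "y = (\<lambda>i. \<Sum>k<N. resolvent N z h $$ (i, k) * complex_of_real (u k))"
  define x where "x = (\<lambda>i. \<Sum>k<N. resolvent N z h' $$ (i, k) * complex_of_real (u k))"
  define p where "p = (\<Sum>i<N. of_real (u i) * y i)"
  define q where "q = (\<Sum>i<N. of_real (u i) * x i)"
  define Y where "Y = (\<Sum>i<N. (cmod (y i))\<^sup>2)"
  have E: "resolvent N z h $$ (i, j) = resolvent N z h' $$ (i, j) + of_real t * y i * x j"
    if "i < N" "j < N" for i j
    unfolding y_def x_def using resolvent_rank_one_identity[OF h z h' that] .
  have y: "y i = x i + of_real t * y i * q" if "i < N" for i
  proof -
    have "y i = (\<Sum>k<N. resolvent N z h $$ (i, k) * of_real (u k))"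
      by (simp add: y_def)
    also have "\<dots> = (\<Sum>k<N. (resolvent N z h' $$ (i, k) + of_real t * y i * x k) * of_real (u k))"
      by (intro sum.cong refl) (use that E in simp)
    also have "\<dots> = x i + of_real t * y i * q"
      unfolding x_def[THEN fun_cong, of i] q_def
      by (simp add: sum.distrib sum_distrib_left algebra_simps)
    finally show ?thesis .
  qed
  define s where "s = 1 - of_real t * q"
  have x: "x i = s * y i" if "i < N" for i
    using y[OF that] by (simp add: s_def algebra_simps)
  have q: "q = s * p"
    unfolding q_def p_def sum_distrib_left by (intro sum.cong) (auto simp: x)
  have "s * (1 + of_real t * p) = s + of_real t * q"
    by (simp add: q algebra_simps)
  then have s: "s * (1 + of_real t * p) = 1"
    by (simp add: s_def)
  then have nz: "1 + of_real t * p \<noteq> 0" by auto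
  have "mat_trace (resolvent N z h) - mat_trace (resolvent N z h') = (\<Sum>i<N. of_real t * y i * x i)"
    by (simp add: mat_trace_resolvent h s' z E sum.distrib)
  also have "\<dots> = of_real t * s * (\<Sum>i<N. (y i)\<^sup>2)"
    unfolding sum_distrib_left by (intro sum.cong) (auto simp: x power2_eq_square)
  finally have "(mat_trace (resolvent N z h) - mat_trace (resolvent N z h')) * (1 + of_real t * p)
      = of_real t * (\<Sum>i<N. (y i)\<^sup>2) * (s * (1 + of_real t * p))"
    by (simp only: ac_simps)
  then have tr: "(mat_trace (resolvent N z h) - mat_trace (resolvent N z h')) * (1 + of_real t * p)
      = of_real t * (\<Sum>i<N. (y i)\<^sup>2)"
    by (simp only: s mult_1_right)
  have "\<bar>Im z\<bar> * (\<bar>t\<bar> * Y) = \<bar>Im (1 + of_real t * p)\<bar>"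
    using resolvent_form[OF h z, of u] sum_nonneg[of "{..<N}" "\<lambda>i. (cmod (y i))\<^sup>2"]
    by (simp add: abs_mult p_def Y_def y_def)
  also have "\<dots> \<le> cmod (1 + of_real t * p)" by (rule abs_Im_le_cmod)
  finally have lower: "\<bar>Im z\<bar> * (\<bar>t\<bar> * Y) \<le> cmod (1 + of_real t * p)" .
  have "cmod (mat_trace (resolvent N z h) - mat_trace (resolvent N z h')) * cmod (1 + of_real t * p)
      = \<bar>t\<bar> * cmod (\<Sum>i<N. (y i)\<^sup>2)"
    using arg_cong[OF tr, of cmod] by (simp add: norm_mult)
  also have "\<dots> \<le> \<bar>t\<bar> * Y"
    unfolding Y_def by (intro mult_left_mono order_trans[OF norm_sum]) (auto simp: norm_power)
  also have "\<dots> \<le> 1 / \<bar>Im z\<bar> * cmod (1 + of_real t * p)"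
    using lower z by (simp add: field_simps)
  finally show ?thesis using nz by (metis mult_le_cancel_right_pos zero_less_norm_iff)
qed

text \<open>
  Changing row and column \<open>k\<close> of a symmetric matrix adds \<open>e w\<^sup>T + w e\<^sup>T\<close> with \<open>e\<close> the \<open>k\<close>-th unit vector,
  which is half of \<open>(e + w) (e + w)\<^sup>T - (e - w) (e - w)\<^sup>T\<close>: two real rank-one updates.
\<close>

lemma trace_resolvent_row_change:
  assumes h: "symmetric_on N h" and h': "symmetric_on N h'" and z: "Im z \<noteq> 0"
    and eq: "\<And>i j. i < N \<Longrightarrow> j < N \<Longrightarrow> i \<noteq> k \<Longrightarrow> j \<noteq> k \<Longrightarrow> h' i j = h i j"
  shows "cmod (mat_trace (resolvent N z h) - mat_trace (resolvent N z h')) \<le> 2 / \<bar>Im z\<bar>"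
proof -
  \<comment> \<open>The diagonal entry is halved because \<open>e w\<^sup>T + w e\<^sup>T\<close> counts it twice.\<close>
  define w where "w = (\<lambda>j. if j = k then (h' k k - h k k) / 2 else h' k j - h k j)"
  define e where "e = (\<lambda>j. if j = k then 1 else 0 :: real)"
  define g where "g = (\<lambda>i j. h i j + 1 / 2 * (e i + w i) * (e j + w j))"
  have sg: "symmetric_on N g" using h by (auto simp: symmetric_on_def g_def)
  have "h' i j = g i j + (- 1 / 2) * (e i - w i) * (e j - w j)" if ij: "i < N" "j < N" for i j
  proof -
    have "g i j + (- 1 / 2) * (e i - w i) * (e j - w j) = h i j + e i * w j + w i * e j"
      by (simp add: g_def field_simps)
    also have "\<dots> = h' i j"
      using eq[OF ij] h h' ij by (auto simp: e_def w_def symmetric_on_def)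
    finally show ?thesis ..
  qed
  from trace_resolvent_rank_one[OF sg z this]
  have "cmod (mat_trace (resolvent N z g) - mat_trace (resolvent N z h')) \<le> 1 / \<bar>Im z\<bar>" .
  moreover have "cmod (mat_trace (resolvent N z h) - mat_trace (resolvent N z g)) \<le> 1 / \<bar>Im z\<bar>"
    by (rule trace_resolvent_rank_one[OF h z, where t = "1 / 2" and u = "\<lambda>j. e j + w j"])
      (simp add: g_def)
  ultimately show ?thesis
    using norm_triangle_ineq[of "mat_trace (resolvent N z h) - mat_trace (resolvent N z g)"
      "mat_trace (resolvent N z g) - mat_trace (resolvent N z h')"] by simp
qed

section \<open>Measurability of the trace of the resolvent\<close>

lemma borel_measurable_det:
  fixes A :: "'a \<Rightarrow> complex mat"
  assumes "\<And>\<omega>. A \<omega> \<in> carrier_mat N N"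
    and "\<And>i j. i < N \<Longrightarrow> j < N \<Longrightarrow> (\<lambda>\<omega>. A \<omega> $$ (i, j)) \<in> borel_measurable M"
  shows "(\<lambda>\<omega>. Determinant.det (A \<omega>)) \<in> borel_measurable M"
proof -
  have "p i < N" if "p permutes {0..<N}" "i < N" for p i
    using permutes_in_image[OF that(1), of i] that(2) by simp
  then show ?thesis
    unfolding det_def'[OF assms(1)]
    by (intro borel_measurable_sum borel_measurable_times borel_measurable_const
        borel_measurable_prod assms(2)) auto
qed

text \<open>
  Cramer's rule writes the trace of the resolvent as a quotient of polynomials in the entries, which
  is what makes it measurable.
\<close>

lemma mat_trace_resolvent_eq_adj:
  assumes "symmetric_on N h" "Im z \<noteq> 0"
  shows "mat_trace (resolvent N z h)
    = (\<Sum>i<N. Determinant.cofactor (shifted_mat N z h) i i) / Determinant.det (shifted_mat N z h)"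
proof -
  let ?A = "shifted_mat N z h"
  note c = shifted_mat_carrier[of N z h]
  note nz = det_shifted_mat_nonzero[OF assms]
  have "resolvent N z h = (1 / Determinant.det ?A) \<cdot>\<^sub>m adj_mat ?A"
  proof (intro resolvent_unique assms)
    show "(1 / Determinant.det ?A) \<cdot>\<^sub>m adj_mat ?A \<in> carrier_mat N N"
      using adj_mat(1)[OF c] by simp
    have "(1 / Determinant.det ?A) \<cdot>\<^sub>m adj_mat ?A * ?A = (1 / Determinant.det ?A) \<cdot>\<^sub>m (adj_mat ?A * ?A)"
      using adj_mat(1)[OF c] c by (rule mult_smult_assoc_mat)
    then show "(1 / Determinant.det ?A) \<cdot>\<^sub>m adj_mat ?A * ?A = 1\<^sub>m N"
      using nz by (intro eq_matI) (auto simp: adj_mat(3)[OF c])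
  qed
  then show ?thesis
    using adj_mat(1)[OF c] c by (auto simp: mat_trace_def adj_mat_def sum_divide_distrib)
qed

lemma borel_measurable_trace_resolvent:
  assumes sym: "\<And>\<omega>. symmetric_on N (h \<omega>)" and z: "Im z \<noteq> 0"
    and h [measurable]: "\<And>i j. i < N \<Longrightarrow> j < N \<Longrightarrow> (\<lambda>\<omega>. h \<omega> i j) \<in> borel_measurable M"
  shows "(\<lambda>\<omega>. mat_trace (resolvent N z (h \<omega>))) \<in> borel_measurable M"
proof -
  have entry: "(\<lambda>\<omega>. shifted_mat N z (h \<omega>) $$ (i, j)) \<in> borel_measurable M" if "i < N" "j < N" for i j
    unfolding shifted_mat_index[OF that] using that by measurable
  have det: "(\<lambda>\<omega>. Determinant.det (shifted_mat N z (h \<omega>))) \<in> borel_measurable M"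
    by (intro borel_measurable_det[of _ N] shifted_mat_carrier entry)
  have cof: "(\<lambda>\<omega>. Determinant.cofactor (shifted_mat N z (h \<omega>)) i i) \<in> borel_measurable M" if i: "i < N" for i
    unfolding Determinant.cofactor_def
  proof (intro borel_measurable_times borel_measurable_const borel_measurable_det[of _ "N - 1"])
    show "mat_delete (shifted_mat N z (h \<omega>)) i i \<in> carrier_mat (N - 1) (N - 1)" for \<omega>
      using shifted_mat_carrier[of N z "h \<omega>"] by (auto simp: mat_delete_def)
    show "(\<lambda>\<omega>. mat_delete (shifted_mat N z (h \<omega>)) i i $$ (r, c)) \<in> borel_measurable M"
      if "r < N - 1" "c < N - 1" for r c
    proof -
      have "mat_delete (shifted_mat N z (h \<omega>)) i i $$ (r, c)
        = shifted_mat N z (h \<omega>) $$ (insert_index i r, insert_index i c)" for \<omega>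
        using that shifted_mat_carrier[of N z "h \<omega>"] by (auto simp: mat_delete_def insert_index_def)
      then show ?thesis
        using that by (auto simp: insert_index_def intro!: entry)
    qed
  qed
  show ?thesis
    unfolding mat_trace_resolvent_eq_adj[OF sym z]
    using det cof by (intro borel_measurable_divide borel_measurable_sum) auto
qed

section \<open>The Efron-Stein inequality for bounded differences\<close>

text \<open>
  A function whose values differ by at most \<open>c\<close> stays within \<open>c\<close> of its mean. The bound is put as a
  second moment, the form that adds up when one coordinate after another is integrated out.
\<close>

lemma (in prob_space) variance_le_of_diff_bound:
  fixes f :: "'a \<Rightarrow> real"
  assumes f: "f \<in> borel_measurable M"
    and bnd: "\<And>x. x \<in> space M \<Longrightarrow> \<bar>f x\<bar> \<le> B"
    and diff: "\<And>x y. x \<in> space M \<Longrightarrow> y \<in> space M \<Longrightarrow> \<bar>f x - f y\<bar> \<le> c"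
  shows "expectation (\<lambda>x. (f x)\<^sup>2) \<le> (expectation f)\<^sup>2 + c\<^sup>2"
proof -
  have int: "integrable M f"
    using f bnd by (intro integrable_const_bound[where B = B] AE_I2) auto
  have int2: "integrable M (\<lambda>x. (f x)\<^sup>2)"
  proof (intro integrable_const_bound[where B = "B\<^sup>2"] AE_I2)
    fix x assume "x \<in> space M"
    then show "norm ((f x)\<^sup>2) \<le> B\<^sup>2"
      using power_mono[OF bnd abs_ge_zero, of x 2] by simp
  qed (use f in measurable)
  have dev: "\<bar>f x - expectation f\<bar> \<le> c" if x: "x \<in> space M" for x
  proof -
    have "f x - c \<le> expectation f"
      using diff[OF x] by (intro integral_ge_const int AE_I2) force
    moreover have "expectation f \<le> f x + c"
      using diff[OF x] by (intro integral_le_const int AE_I2) force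
    ultimately show ?thesis by linarith
  qed
  have "variance f \<le> c\<^sup>2"
  proof (intro integral_le_const AE_I2)
    show "integrable M (\<lambda>x. (f x - expectation f)\<^sup>2)"
      unfolding power2_diff using int int2 by (intro Bochner_Integration.integrable_add
        Bochner_Integration.integrable_diff) auto
    show "(f x - expectation f)\<^sup>2 \<le> c\<^sup>2" if "x \<in> space M" for x
      using dev[OF that] abs_le_square_iff abs_ge_self order_trans by blast
  qed
  then show ?thesis using variance_eq[OF int int2] by simp
qed

text \<open>
  The Efron-Stein inequality for functions with bounded differences. Integrating out one coordinate
  \<open>k\<close> replaces \<open>f\<close> by its partial mean \<open>h\<close>: on each fibre the second moment of \<open>f\<close> exceeds \<open>h\<^sup>2\<close> by at
  most \<open>(c k)\<^sup>2\<close>, and \<open>h\<close>, an average of functions with the same differences, inherits the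
  bounds for the other coordinates.
\<close>

lemma second_moment_bounded_differences:
  fixes f :: "('i \<Rightarrow> 'b) \<Rightarrow> real"
  assumes prob_P: "\<And>i. prob_space (P i)"
    and "finite I"
    and "f \<in> borel_measurable (PiM I P)"
    and "\<And>x. x \<in> space (PiM I P) \<Longrightarrow> \<bar>f x\<bar> \<le> B"
    and "\<And>k x y. k \<in> I \<Longrightarrow> x \<in> space (PiM I P) \<Longrightarrow> y \<in> space (P k) \<Longrightarrow> \<bar>f x - f (x(k := y))\<bar> \<le> c k"
  shows "(\<integral>x. (f x)\<^sup>2 \<partial>PiM I P) \<le> (\<integral>x. f x \<partial>PiM I P)\<^sup>2 + (\<Sum>k\<in>I. (c k)\<^sup>2)"
  using assms(2-)
proof (induction I arbitrary: f rule: finite_induct)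
  case empty
  interpret product_sigma_finite P
    by (intro product_sigma_finite.intro prob_space_imp_sigma_finite prob_P)
  show ?case by (simp add: PiM_empty lebesgue_integral_count_space_finite)
next
  case (insert k I)
  interpret Pk: prob_space "P k" by (rule prob_P)
  interpret PI: prob_space "PiM I P" by (intro prob_space_PiM prob_P)
  interpret PkI: prob_space "PiM (insert k I) P" by (intro prob_space_PiM prob_P)
  interpret product_sigma_finite P
    by (intro product_sigma_finite.intro prob_space_imp_sigma_finite prob_P)
  note f [measurable] = insert.prems(1)
  define h where "h = (\<lambda>x. \<integral>y. f (x(k := y)) \<partial>P k)"
  have upd: "x(k := y) \<in> space (PiM (insert k I) P)"
    if "x \<in> space (PiM I P)" "y \<in> space (P k)" for x y
    using that by (auto simp: space_PiM PiE_def extensional_def Pi_iff)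
  have f2 [measurable]: "(\<lambda>(x, y). f (x(k := y))) \<in> borel_measurable (PiM I P \<Otimes>\<^sub>M P k)"
    using measurable_compose[OF measurable_add_dim f] by (simp add: case_prod_beta')
  have fx [measurable]: "(\<lambda>y. f (x(k := y))) \<in> borel_measurable (P k)" if "x \<in> space (PiM I P)" for x
    using measurable_compose[OF measurable_Pair1'[OF that] f2] by simp
  have h_meas: "h \<in> borel_measurable (PiM I P)"
    unfolding h_def by (rule Pk.borel_measurable_lebesgue_integral) (rule f2)
  have int_fx: "integrable (P k) (\<lambda>y. f (x(k := y)))" if "x \<in> space (PiM I P)" for x
    using that insert.prems(2) upd
    by (intro Pk.integrable_const_bound[where B = B] AE_I2 fx) auto
  have h_bnd: "\<bar>h x\<bar> \<le> B" if x: "x \<in> space (PiM I P)" for x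
  proof -
    have range: "f (x(k := y)) \<le> B" "- B \<le> f (x(k := y))" if "y \<in> space (P k)" for y
      using insert.prems(2)[OF upd[OF x that]] by linarith+
    have "h x \<le> B" unfolding h_def
      using range(1) by (intro Pk.integral_le_const int_fx x AE_I2)
    moreover have "- B \<le> h x" unfolding h_def
      using range(2) by (intro Pk.integral_ge_const int_fx x AE_I2)
    ultimately show ?thesis by simp
  qed
  have h_diff: "\<bar>h x - h (x(i := w))\<bar> \<le> c i"
    if i: "i \<in> I" and x: "x \<in> space (PiM I P)" and w: "w \<in> space (P i)" for i x w
  proof -
    have xw: "x(i := w) \<in> space (PiM I P)"
      using i x w by (auto simp: space_PiM PiE_def extensional_def Pi_iff)
    have d: "\<bar>f (x(k := y)) - f ((x(i := w))(k := y))\<bar> \<le> c i" if y: "y \<in> space (P k)" for y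
    proof -
      have "(x(i := w))(k := y) = (x(k := y))(i := w)"
        using i insert.hyps(2) by (auto intro: fun_upd_twist)
      then show ?thesis using insert.prems(3)[OF insertI2[OF i] upd[OF x y] w] by (simp only:)
    qed
    have eq: "h x - h (x(i := w)) = (\<integral>y. f (x(k := y)) - f ((x(i := w))(k := y)) \<partial>P k)"
      unfolding h_def by (intro Bochner_Integration.integral_diff[symmetric] int_fx x xw)
    have int: "integrable (P k) (\<lambda>y. f (x(k := y)) - f ((x(i := w))(k := y)))"
      by (intro Bochner_Integration.integrable_diff int_fx x xw)
    have range: "f (x(k := y)) - f ((x(i := w))(k := y)) \<le> c i"
        "- c i \<le> f (x(k := y)) - f ((x(i := w))(k := y))" if "y \<in> space (P k)" for y
      using d[OF that] by linarith+
    have "h x - h (x(i := w)) \<le> c i" unfolding eq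
      using range(1) by (intro Pk.integral_le_const int AE_I2)
    moreover have "- c i \<le> h x - h (x(i := w))" unfolding eq
      using range(2) by (intro Pk.integral_ge_const int AE_I2)
    ultimately show ?thesis by simp
  qed
  have sq: "norm (r\<^sup>2) \<le> B\<^sup>2" if "\<bar>r\<bar> \<le> B" for r
    using power_mono[OF that abs_ge_zero, of 2] by simp
  have int_h2: "integrable (PiM I P) (\<lambda>x. (h x)\<^sup>2)"
    using h_meas h_bnd by (intro PI.integrable_const_bound[where B = "B\<^sup>2"] AE_I2 sq) auto
  have int_f: "integrable (PiM (insert k I) P) f"
    using f insert.prems(2) by (intro PkI.integrable_const_bound[where B = B] AE_I2) auto
  have int_f2: "integrable (PiM (insert k I) P) (\<lambda>x. (f x)\<^sup>2)"
    using f insert.prems(2)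
    by (intro PkI.integrable_const_bound[where B = "B\<^sup>2"] AE_I2 sq) measurable
  have F1: "(\<integral>x. f x \<partial>PiM (insert k I) P) = (\<integral>x. h x \<partial>PiM I P)"
    unfolding h_def by (intro product_integral_insert insert.hyps int_f)
  have fibre: "(\<integral>y. (f (x(k := y)))\<^sup>2 \<partial>P k) \<le> (h x)\<^sup>2 + (c k)\<^sup>2"
    if x: "x \<in> space (PiM I P)" for x
    unfolding h_def
  proof (rule Pk.variance_le_of_diff_bound[OF fx[OF x]])
    show "\<bar>f (x(k := y))\<bar> \<le> B" if "y \<in> space (P k)" for y
      using insert.prems(2)[OF upd[OF x that]] .
    show "\<bar>f (x(k := y)) - f (x(k := y'))\<bar> \<le> c k" if "y \<in> space (P k)" "y' \<in> space (P k)" for y y'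
      using insert.prems(3)[OF insertI1 upd[OF x that(1)] that(2)] by (simp only: fun_upd_upd)
  qed
  have "(\<integral>x. (f x)\<^sup>2 \<partial>PiM (insert k I) P) = (\<integral>x. (\<integral>y. (f (x(k := y)))\<^sup>2 \<partial>P k) \<partial>PiM I P)"
    by (intro product_integral_insert insert.hyps int_f2)
  also have "\<dots> \<le> (\<integral>x. (h x)\<^sup>2 + (c k)\<^sup>2 \<partial>PiM I P)"
    using int_h2 fibre
    by (intro integral_mono' Bochner_Integration.integrable_add PI.integrable_const) (auto simp: add_nonneg_nonneg)
  also have "\<dots> = (\<integral>x. (h x)\<^sup>2 \<partial>PiM I P) + (c k)\<^sup>2"
    using int_h2 by (simp add: PI.prob_space)
  also have "\<dots> \<le> (\<integral>x. h x \<partial>PiM I P)\<^sup>2 + (\<Sum>i\<in>I. (c i)\<^sup>2) + (c k)\<^sup>2"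
    using insert.IH[OF h_meas h_bnd h_diff] by simp
  finally show ?case using insert.hyps F1 by simp
qed

text \<open>
  Independence means that the joint law of the \<open>X k\<close> is a product measure, so the product
  inequality applies to a function of these variables.
\<close>

lemma (in prob_space) variance_bounded_differences:
  fixes X :: "'i \<Rightarrow> 'a \<Rightarrow> 'b" and f :: "('i \<Rightarrow> 'b) \<Rightarrow> real"
  assumes L: "finite L" "L \<noteq> {}"
    and X: "\<And>k. random_variable (P k) (X k)" "indep_vars P X L"
    and f [measurable]: "f \<in> borel_measurable (PiM L P)"
    and bnd: "\<And>x. x \<in> space (PiM L P) \<Longrightarrow> \<bar>f x\<bar> \<le> B"
    and diff: "\<And>k x y. k \<in> L \<Longrightarrow> x \<in> space (PiM L P) \<Longrightarrow> y \<in> space (P k) \<Longrightarrow> \<bar>f x - f (x(k := y))\<bar> \<le> c k"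
  shows "variance (\<lambda>\<omega>. f (\<lambda>k\<in>L. X k \<omega>)) \<le> (\<Sum>k\<in>L. (c k)\<^sup>2)"
proof -
  let ?X = "\<lambda>\<omega>. \<lambda>k\<in>L. X k \<omega>" and ?Q = "\<lambda>k. distr M (P k) (X k)"
  have X_meas [measurable]: "?X \<in> measurable M (PiM L P)"
    by (intro measurable_restrict X(1))
  have sets_Q: "sets (PiM L ?Q) = sets (PiM L P)"
    by (intro sets_PiM_cong) auto
  have space_Q: "space (PiM L ?Q) = space (PiM L P)"
    by (rule sets_eq_imp_space_eq[OF sets_Q])
  have law: "distr M (PiM L P) ?X = PiM L ?Q"
    using indep_vars_iff_distr_eq_PiM[OF L(2), where M' = P and X = X] X by blast
  have transfer: "(\<integral>x. g x \<partial>PiM L ?Q) = expectation (\<lambda>\<omega>. g (?X \<omega>))"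
    if "g \<in> borel_measurable (PiM L P)" for g :: "_ \<Rightarrow> real"
    unfolding law[symmetric] using that by (intro integral_distr) auto
  have "(\<integral>x. (f x)\<^sup>2 \<partial>PiM L ?Q) \<le> (\<integral>x. f x \<partial>PiM L ?Q)\<^sup>2 + (\<Sum>k\<in>L. (c k)\<^sup>2)"
  proof (rule second_moment_bounded_differences[where B = B])
    show "prob_space (?Q k)" for k by (intro prob_space_distr X(1))
    show "f \<in> borel_measurable (PiM L ?Q)"
      using f by (simp add: measurable_cong_sets[OF sets_Q refl])
    show "\<bar>f x\<bar> \<le> B" if "x \<in> space (PiM L ?Q)" for x
      using that bnd by (simp add: space_Q)
    show "\<bar>f x - f (x(k := y))\<bar> \<le> c k" if "k \<in> L" "x \<in> space (PiM L ?Q)" "y \<in> space (?Q k)" for k x y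
      using that diff by (simp add: space_Q)
  qed (rule L(1))
  then have le: "expectation (\<lambda>\<omega>. (f (?X \<omega>))\<^sup>2) \<le> (expectation (\<lambda>\<omega>. f (?X \<omega>)))\<^sup>2 + (\<Sum>k\<in>L. (c k)\<^sup>2)"
    by (simp add: transfer)
  have b: "\<bar>f (?X \<omega>)\<bar> \<le> B" if "\<omega> \<in> space M" for \<omega>
    using bnd measurable_space[OF X_meas that] .
  have "integrable M (\<lambda>\<omega>. f (?X \<omega>))"
    using b by (intro integrable_const_bound[where B = B] AE_I2) auto
  moreover have "integrable M (\<lambda>\<omega>. (f (?X \<omega>))\<^sup>2)"
  proof (intro integrable_const_bound[where B = "B\<^sup>2"] AE_I2)
    fix \<omega> assume "\<omega> \<in> space M"
    then show "norm ((f (?X \<omega>))\<^sup>2) \<le> B\<^sup>2"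
      using power_mono[OF b abs_ge_zero, of \<omega> 2] by simp
  qed measurable
  ultimately show ?thesis using variance_eq le by simp
qed

lemma (in prob_space) complex_variance_eq:
  assumes [measurable]: "f \<in> borel_measurable M"
    and "\<And>\<omega>. \<omega> \<in> space M \<Longrightarrow> cmod (f \<omega>) \<le> B"
  shows "complex_variance M f = variance (\<lambda>\<omega>. Re (f \<omega>)) + variance (\<lambda>\<omega>. Im (f \<omega>))"
proof -
  have f: "integrable M f"
    using assms by (intro integrable_const_bound[where B = B] AE_I2) auto
  have dev: "integrable M (\<lambda>\<omega>. (g \<omega> - m)\<^sup>2)"
    if [measurable]: "g \<in> borel_measurable M" and g: "\<And>\<omega>. \<omega> \<in> space M \<Longrightarrow> \<bar>g \<omega>\<bar> \<le> B" for g :: "'a \<Rightarrow> real" and m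
  proof (intro integrable_const_bound[where B = "(B + \<bar>m\<bar>)\<^sup>2"] AE_I2)
    fix \<omega> assume "\<omega> \<in> space M"
    then have "\<bar>g \<omega> - m\<bar> \<le> B + \<bar>m\<bar>" using g[of \<omega>] by linarith
    then show "norm ((g \<omega> - m)\<^sup>2) \<le> (B + \<bar>m\<bar>)\<^sup>2"
      using power_mono[OF _ abs_ge_zero, of "g \<omega> - m" "B + \<bar>m\<bar>" 2] by simp
  qed measurable
  have "complex_variance M f
    = (\<integral>\<omega>. (Re (f \<omega>) - expectation (\<lambda>\<omega>. Re (f \<omega>)))\<^sup>2 + (Im (f \<omega>) - expectation (\<lambda>\<omega>. Im (f \<omega>)))\<^sup>2 \<partial>M)"
    unfolding complex_variance_def cmod_power2 minus_complex.sel
    using f by (simp add: integral_Re integral_Im)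
  also have "\<dots> = variance (\<lambda>\<omega>. Re (f \<omega>)) + variance (\<lambda>\<omega>. Im (f \<omega>))"
  proof (intro Bochner_Integration.integral_add dev)
    show "\<bar>Re (f \<omega>)\<bar> \<le> B" "\<bar>Im (f \<omega>)\<bar> \<le> B" if "\<omega> \<in> space M" for \<omega>
      using assms(2)[OF that] abs_Re_le_cmod[of "f \<omega>"] abs_Im_le_cmod[of "f \<omega>"] by linarith+
  qed measurable
  finally show ?thesis .
qed

section \<open>Independence of the row blocks\<close>

text \<open>
  For a finite family it suffices to factor the probability of a single intersection over all
  indices. The mutual independence of the two families splits it into two intersections, and the
  independence inside each family splits these.
\<close>

lemma (in prob_space) indep_vars_disjoint_union:
  fixes X :: "'i \<Rightarrow> 'a \<Rightarrow> 'b" and Y :: "'i \<Rightarrow> 'a \<Rightarrow> 'b"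
  assumes fin: "finite I" "finite J"
    and X: "indep_vars (\<lambda>_. S) X I" and Y: "indep_vars (\<lambda>_. S) Y J"
    and XY: "indep_var (PiM I (\<lambda>_. S)) (\<lambda>\<omega>. \<lambda>i\<in>I. X i \<omega>) (PiM J (\<lambda>_. S)) (\<lambda>\<omega>. \<lambda>j\<in>J. Y j \<omega>)"
    and ne: "I \<noteq> {}" "J \<noteq> {}"
  shows "indep_vars (\<lambda>_. S) (case_sum X Y) (I <+> J)"
proof (rule indep_vars_finite[where E = "\<lambda>_. sets S", THEN iffD2])
  show "I <+> J \<noteq> {}" using ne by auto
  show "finite (I <+> J)" using fin by (rule finite_Plus)
  show "random_variable S (case_sum X Y s)" if "s \<in> I <+> J" for s
    using that X Y by (auto simp: indep_vars_def)
  show "sets S = sigma_sets (space S) (sets S)" for s :: "'i + 'i"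
    by (rule sets.sigma_sets_eq[symmetric])
  show "Int_stable (sets S)" by (auto simp: Int_stable_def)
  show "space S \<in> sets S" by simp
  show "sets S \<subseteq> Pow (space S)" by (rule sets.space_closed)
  show "\<forall>A\<in>Pi (I <+> J) (\<lambda>_. sets S).
      prob (\<Inter>s\<in>I <+> J. case_sum X Y s -` A s \<inter> space M)
      = (\<Prod>s\<in>I <+> J. prob (case_sum X Y s -` A s \<inter> space M))"
  proof
    fix A assume A: "A \<in> Pi (I <+> J) (\<lambda>_. sets S)"
    let ?RX = "\<lambda>\<omega>. \<lambda>i\<in>I. X i \<omega>" and ?RY = "\<lambda>\<omega>. \<lambda>j\<in>J. Y j \<omega>"
    let ?EX = "PiE I (\<lambda>i. A (Inl i))" and ?EY = "PiE J (\<lambda>j. A (Inr j))"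
    have sX: "?RX -` ?EX \<inter> space M = (\<Inter>i\<in>I. X i -` A (Inl i) \<inter> space M)"
      using ne by auto
    have sY: "?RY -` ?EY \<inter> space M = (\<Inter>j\<in>J. Y j -` A (Inr j) \<inter> space M)"
      using ne by auto
    have "(\<Inter>s\<in>I <+> J. case_sum X Y s -` A s \<inter> space M)
      = (\<lambda>\<omega>. (?RX \<omega>, ?RY \<omega>)) -` (?EX \<times> ?EY) \<inter> space M"
      using ne by (auto simp: Plus_def ball_Un)
    then have "prob (\<Inter>s\<in>I <+> J. case_sum X Y s -` A s \<inter> space M)
      = prob (?RX -` ?EX \<inter> space M) * prob (?RY -` ?EY \<inter> space M)"
      using indep_varD[OF XY, of ?EX ?EY] A fin by (auto intro!: sets_PiM_I_finite)
    also have "prob (?RX -` ?EX \<inter> space M) = (\<Prod>i\<in>I. prob (X i -` A (Inl i) \<inter> space M))"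
      unfolding sX using A fin ne by (intro indep_varsD[OF X]) auto
    also have "prob (?RY -` ?EY \<inter> space M) = (\<Prod>j\<in>J. prob (Y j -` A (Inr j) \<inter> space M))"
      unfolding sY using A fin ne by (intro indep_varsD[OF Y]) auto
    finally show "prob (\<Inter>s\<in>I <+> J. case_sum X Y s -` A s \<inter> space M)
      = (\<Prod>s\<in>I <+> J. prob (case_sum X Y s -` A s \<inter> space M))"
      by (simp only: prod.Plus[OF fin] comp_def sum.case)
  qed
qed

context long_range_percolation
begin

definition upper_index :: "nat \<Rightarrow> (int \<times> int) set" where
  "upper_index n = {(i, j). - int n \<le> i \<and> i \<le> j \<and> j \<le> int n}"

definition entry_var :: "nat \<Rightarrow> (int \<times> int) + (int \<times> int) \<Rightarrow> 'w \<Rightarrow> real" where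
  "entry_var n = case_sum (\<lambda>(i, j). d n i j) (\<lambda>(i, j). a i j)"

text \<open>
  Assigning a variable with index \<open>(i, j)\<close>, \<open>i \<le> j\<close>, to its smaller index \<open>i\<close> makes the blocks disjoint,
  hence independent. The blocks with \<open>- n \<le> k \<le> n\<close> together contain all variables that enter the
  matrix, the other blocks being empty.
\<close>

definition row_block :: "nat \<Rightarrow> int \<Rightarrow> ((int \<times> int) + (int \<times> int)) set" where
  "row_block n k = {s \<in> upper_index n <+> upper_index n. fst (case_sum id id s) = k}"

text \<open>
  The matrix as a function of the row blocks \<open>x\<close>: the entry in row \<open>i\<close> and column \<open>j\<close> with \<open>i \<le> j\<close> is
  read off block \<open>i\<close> only, so that altering block \<open>k\<close> affects nothing outside row and column \<open>k\<close>.
\<close>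

definition block_matrix ::
  "nat \<Rightarrow> (int \<Rightarrow> (int \<times> int) + (int \<times> int) \<Rightarrow> real) \<Rightarrow> nat \<Rightarrow> nat \<Rightarrow> real" where
  "block_matrix n x r s = (let i = min (int r - int n) (int s - int n); j = max (int r - int n) (int s - int n)
    in x i (Inr (i, j)) * x i (Inl (i, j)) / sqrt (real (b n)))"

lemma finite_upper_index: "finite (upper_index n)"
  by (rule finite_subset[of _ "{- int n..int n} \<times> {- int n..int n}"]) (auto simp: upper_index_def)

lemma indep_entry_vars: "indep_vars (\<lambda>_. borel) (entry_var n) (upper_index n <+> upper_index n)"
  unfolding entry_var_def
proof (rule indep_vars_disjoint_union)
  have sub: "upper_index n \<subseteq> {(i, j). i \<le> j}" by (auto simp: upper_index_def)
  show "indep_vars (\<lambda>_. borel) (\<lambda>(i, j). a i j) (upper_index n)"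
    by (rule indep_vars_subset[OF a_indep sub])
  show "indep_vars (\<lambda>_. borel) (\<lambda>(i, j). d n i j) (upper_index n)"
    unfolding upper_index_def by (rule d_indep)
  have "indep_var (PiM (upper_index n) (\<lambda>_. borel)) (id \<circ> (\<lambda>\<omega>. \<lambda>(i, j)\<in>upper_index n. d n i j \<omega>))
      (PiM (upper_index n) (\<lambda>_. borel))
      ((\<lambda>f. restrict f (upper_index n)) \<circ> (\<lambda>\<omega>. \<lambda>(i, j)\<in>{(i, j). i \<le> j}. a i j \<omega>))"
    using d_indep_a unfolding upper_index_def[symmetric]
    by (rule indep_var_compose) (auto intro!: measurable_restrict_subset sub)
  moreover have "(\<lambda>f. restrict f (upper_index n)) \<circ> (\<lambda>\<omega>. \<lambda>(i, j)\<in>{(i, j). i \<le> j}. a i j \<omega>)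
      = (\<lambda>\<omega>. \<lambda>(i, j)\<in>upper_index n. a i j \<omega>)"
    using sub by (auto simp: fun_eq_iff restrict_def)
  ultimately have da: "indep_var (PiM (upper_index n) (\<lambda>_. borel)) (\<lambda>\<omega>. \<lambda>(i, j)\<in>upper_index n. d n i j \<omega>)
      (PiM (upper_index n) (\<lambda>_. borel)) (\<lambda>\<omega>. \<lambda>(i, j)\<in>upper_index n. a i j \<omega>)"
    by (simp add: comp_def)
  then show "indep_var (PiM (upper_index n) (\<lambda>_. borel)) (\<lambda>\<omega>. \<lambda>p\<in>upper_index n. (case p of (i, j) \<Rightarrow> d n i j) \<omega>)
      (PiM (upper_index n) (\<lambda>_. borel)) (\<lambda>\<omega>. \<lambda>p\<in>upper_index n. (case p of (i, j) \<Rightarrow> a i j) \<omega>)"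
    by (simp add: case_prod_beta')
  have "(0, 0) \<in> upper_index n" by (simp add: upper_index_def)
  then show "upper_index n \<noteq> {}" "upper_index n \<noteq> {}" by auto
qed (rule finite_upper_index)+

lemma block_matrix_symmetric: "symmetric_on N (block_matrix n x)"
  by (auto simp: symmetric_on_def block_matrix_def min.commute max.commute)

section \<open>The variance bound\<close>

text \<open>
  Altering one row block moves the normalised trace by at most \<open>2 / (N \<bar>Im z\<bar>)\<close>. With \<open>N = 2 n + 1\<close>
  independent blocks, the real and the imaginary part each have variance at most
  \<open>N (2 / (N \<bar>Im z\<bar>))\<^sup>2 = 4 / (N \<bar>Im z\<bar>\<^sup>2)\<close>.
\<close>

lemma complex_variance_resolvent_trace_le:
  assumes z: "Im z \<noteq> 0"
  shows "complex_variance M (resolvent_trace b a d n z) \<le> 8 / (real (2 * n + 1) * (Im z)\<^sup>2)"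
proof -
  let ?N = "2 * n + 1" and ?L = "{- int n..int n}"
  let ?P = "\<lambda>k. PiM (row_block n k) (\<lambda>_. borel :: real measure)"
  define X where "X = (\<lambda>k \<omega>. \<lambda>s\<in>row_block n k. entry_var n s \<omega>)"
  define F where "F = (\<lambda>x. mat_trace (resolvent ?N z (block_matrix n x)) / of_nat ?N)"
  define c where "c = 2 / (real ?N * \<bar>Im z\<bar>)"
  have L: "finite ?L" "?L \<noteq> {}" by auto
  have rv: "random_variable (?P k) (X k)" for k
    unfolding X_def using indep_entry_vars[of n]
    by (intro measurable_restrict) (auto simp: indep_vars_def row_block_def)
  \<comment> \<open>Disjoint groups of an independent family are independent.\<close>
  have indep: "indep_vars ?P X ?L"
    unfolding X_def
    by (intro indep_vars_restrict[OF indep_entry_vars]) (auto simp: row_block_def disjoint_family_on_def)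
  have entry: "(\<lambda>x. block_matrix n x r s) \<in> borel_measurable (PiM ?L ?P)" if "r < ?N" "s < ?N" for r s
  proof -
    define i where "i = min (int r - int n) (int s - int n)"
    define j where "j = max (int r - int n) (int s - int n)"
    have ij: "i \<in> ?L" "(i, j) \<in> upper_index n" using that by (auto simp: i_def j_def upper_index_def)
    have comp: "(\<lambda>x. x i t) \<in> borel_measurable (PiM ?L ?P)" if "t \<in> row_block n i" for t
      by (rule measurable_compose[OF measurable_component_singleton[OF ij(1), of ?P]
            measurable_component_singleton[OF that]])
    have "(\<lambda>x. x i (Inr (i, j)) * x i (Inl (i, j)) / sqrt (real (b n))) \<in> borel_measurable (PiM ?L ?P)"
      using ij(2) by (intro borel_measurable_divide borel_measurable_times comp borel_measurable_const)
        (auto simp: row_block_def)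
    then show ?thesis by (simp add: block_matrix_def Let_def i_def j_def)
  qed
  have F_meas: "F \<in> borel_measurable (PiM ?L ?P)"
    unfolding F_def
    by (intro borel_measurable_divide borel_measurable_const borel_measurable_trace_resolvent
        block_matrix_symmetric z entry)
  have F_bnd: "cmod (F x) \<le> 1 / \<bar>Im z\<bar>" for x
    using cmod_trace_resolvent_le[OF block_matrix_symmetric z, of ?N n x]
    by (simp add: F_def norm_divide field_simps del: of_nat_Suc of_nat_add of_nat_mult)
  have F_diff: "cmod (F x - F (x(k := y))) \<le> c" if "k \<in> ?L" for k x y
  proof -
    have "block_matrix n (x(k := y)) r s = block_matrix n x r s"
      if "r \<noteq> nat (k + int n)" "s \<noteq> nat (k + int n)" for r s
    proof -
      have "min (int r - int n) (int s - int n) \<noteq> k" using that by (auto simp: min_def)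
      then show ?thesis by (simp add: block_matrix_def Let_def)
    qed
    then have "cmod (mat_trace (resolvent ?N z (block_matrix n x))
        - mat_trace (resolvent ?N z (block_matrix n (x(k := y))))) \<le> 2 / \<bar>Im z\<bar>"
      by (intro trace_resolvent_row_change[where k = "nat (k + int n)"] block_matrix_symmetric z) auto
    then have "cmod (mat_trace (resolvent ?N z (block_matrix n x))
        - mat_trace (resolvent ?N z (block_matrix n (x(k := y))))) / real ?N \<le> 2 / \<bar>Im z\<bar> / real ?N"
      by (intro divide_right_mono) auto
    then show ?thesis
      unfolding F_def c_def diff_divide_distrib[symmetric] norm_divide norm_of_nat
      by (simp add: mult.commute)
  qed
  have eq: "resolvent_trace b a d n z \<omega> = F (\<lambda>k\<in>?L. X k \<omega>)" for \<omega>
  proof -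
    have "H_entry b a d n \<omega> (int r - int n) (int s - int n) = block_matrix n (\<lambda>k\<in>?L. X k \<omega>) r s"
      if "r < ?N" "s < ?N" for r s
    proof -
      define i where "i = min (int r - int n) (int s - int n)"
      define j where "j = max (int r - int n) (int s - int n)"
      have ij: "i \<in> ?L" "(i, j) \<in> upper_index n" using that by (auto simp: i_def j_def upper_index_def)
      then have "X i \<omega> (Inr (i, j)) = a i j \<omega>" "X i \<omega> (Inl (i, j)) = d n i j \<omega>"
        by (auto simp: X_def row_block_def entry_var_def)
      with ij(1) show ?thesis
        unfolding H_entry_def block_matrix_def Let_def i_def[symmetric] j_def[symmetric] by simp
    qed
    then have "H_mat b a d n \<omega> - z \<cdot>\<^sub>m 1\<^sub>m ?N = shifted_mat ?N z (block_matrix n (\<lambda>k\<in>?L. X k \<omega>))"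
      unfolding H_mat_def shifted_mat_def by (intro eq_matI) auto
    then show ?thesis by (simp add: resolvent_trace_def F_def resolvent_def)
  qed
  \<comment> \<open>Here \<open>\<rho>\<close> stands for the real or the imaginary part.\<close>
  have part: "variance (\<lambda>\<omega>. \<rho> (F (\<lambda>k\<in>?L. X k \<omega>))) \<le> real ?N * c\<^sup>2"
    if \<rho>: "\<rho> \<in> borel_measurable borel" "\<And>w. \<bar>\<rho> w\<bar> \<le> cmod w" "\<And>w w'. \<rho> (w - w') = \<rho> w - \<rho> w'"
    for \<rho> :: "complex \<Rightarrow> real"
  proof -
    have "variance (\<lambda>\<omega>. \<rho> (F (\<lambda>k\<in>?L. X k \<omega>))) \<le> (\<Sum>k\<in>?L. c\<^sup>2)"
    proof (rule variance_bounded_differences[where f = "\<lambda>x. \<rho> (F x)" and B = "1 / \<bar>Im z\<bar>", OF L rv indep])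
      show "(\<lambda>x. \<rho> (F x)) \<in> borel_measurable (PiM ?L ?P)"
        using F_meas \<rho>(1) by (rule measurable_compose)
      show "\<bar>\<rho> (F x)\<bar> \<le> 1 / \<bar>Im z\<bar>" for x
        using \<rho>(2) F_bnd by (rule order_trans)
      show "\<bar>\<rho> (F x) - \<rho> (F (x(k := y)))\<bar> \<le> c" if "k \<in> ?L" for k x y
        unfolding \<rho>(3)[symmetric] using \<rho>(2) F_diff[OF that] by (rule order_trans)
    qed
    then show ?thesis by (simp add: add.commute)
  qed
  have "(\<lambda>\<omega>. F (\<lambda>k\<in>?L. X k \<omega>)) \<in> borel_measurable M"
    by (rule measurable_compose[OF _ F_meas]) (intro measurable_restrict rv)
  then have "complex_variance M (resolvent_trace b a d n z)
    = variance (\<lambda>\<omega>. Re (F (\<lambda>k\<in>?L. X k \<omega>))) + variance (\<lambda>\<omega>. Im (F (\<lambda>k\<in>?L. X k \<omega>)))"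
    unfolding eq[abs_def] using F_bnd by (rule complex_variance_eq)
  also have "\<dots> \<le> real ?N * c\<^sup>2 + real ?N * c\<^sup>2"
    by (intro add_mono part) (auto intro: abs_Re_le_cmod abs_Im_le_cmod)
  also have "\<dots> = 8 / (real ?N * (Im z)\<^sup>2)"
    using z by (simp add: c_def power_divide power_mult_distrib field_simps power2_eq_square del: of_nat_Suc of_nat_add of_nat_mult)
  finally show ?thesis .
qed

end

theorem theorem5p1:
  fixes M :: "'w measure"
    and v :: real
    and \<psi> :: "real \<Rightarrow> real"
    and b :: "nat \<Rightarrow> nat"
    and a :: "int \<Rightarrow> int \<Rightarrow> 'w \<Rightarrow> real"
    and d :: "nat \<Rightarrow> int \<Rightarrow> int \<Rightarrow> 'w \<Rightarrow> real"
  assumes "long_range_percolation M v \<psi> b a d"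
    and "\<And>i p l. l \<in> {0, 1, 2::nat} \<Longrightarrow> (\<integral>\<omega>. a i p \<omega> ^ (2 * l + 1) \<partial>M) = 0"
    and "\<And>i p. (\<integral>\<omega>. a i p \<omega> ^ 2 \<partial>M) = v ^ 2"
    and "\<And>i p. (\<integral>\<omega>. a i p \<omega> ^ 4 \<partial>M) = 3 * v ^ 4"
    and "\<And>i p. (\<integral>\<omega>. a i p \<omega> ^ 6 \<partial>M) = 15 * v ^ 6"
    and "(SUP (i, p) \<in> UNIV. \<integral>\<^sup>+\<omega>. ennreal (\<bar>a i p \<omega>\<bar> ^ 7) \<partial>M) < \<infinity>"
  shows "(\<lambda>(n, z). complex_variance M (resolvent_trace b a d n z))
    \<in> O[sequentially \<times>\<^sub>F principal {z. \<bar>Im z\<bar> \<ge> 2 * v + 1}](\<lambda>(n, z). 1 / real (b n))"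
proof (rule bigoI)
  interpret long_range_percolation M v \<psi> b a d by fact
  have bound: "\<bar>complex_variance M (resolvent_trace b a d n z)\<bar> \<le> 8 / real (b n)"
    if z: "2 * v + 1 \<le> \<bar>Im z\<bar>" for n z
  proof -
    \<comment> \<open>The region of \<open>z\<close> and \<open>b n \<le> 2 n + 1\<close> turn the bound of order \<open>1 / N\<close> into one of order \<open>1 / b n\<close>.\<close>
    have Im1: "1 \<le> \<bar>Im z\<bar>" using z v_pos by simp
    have "(1::real) \<le> (Im z)\<^sup>2" using power_mono[OF Im1, of 2] by simp
    moreover have "real (b n) \<le> real (2 * n + 1)" using b_le[of n] by (rule of_nat_mono)
    ultimately have "real (b n) * 1 \<le> real (2 * n + 1) * (Im z)\<^sup>2"
      by (intro mult_mono) auto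
    then have "8 / (real (2 * n + 1) * (Im z)\<^sup>2) \<le> 8 / real (b n)"
      using b_pos[of n] by (intro divide_left_mono) auto
    moreover have "0 \<le> complex_variance M (resolvent_trace b a d n z)"
      unfolding complex_variance_def by (intro Bochner_Integration.integral_nonneg) auto
    moreover have "complex_variance M (resolvent_trace b a d n z) \<le> 8 / (real (2 * n + 1) * (Im z)\<^sup>2)"
      using Im1 by (intro complex_variance_resolvent_trace_le) auto
    ultimately show ?thesis by simp
  qed
  show "\<forall>\<^sub>F p in sequentially \<times>\<^sub>F principal {z. \<bar>Im z\<bar> \<ge> 2 * v + 1}.
      norm (case p of (n, z) \<Rightarrow> complex_variance M (resolvent_trace b a d n z))
      \<le> 8 * norm (case p of (n, z) \<Rightarrow> 1 / real (b n))"
    unfolding eventually_prod_filter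
    by (intro exI[of _ "\<lambda>_::nat. True"] exI[of _ "\<lambda>z. 2 * v + 1 \<le> \<bar>Im z\<bar>"])
      (auto simp: eventually_principal bound)
qed

end
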